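(* Let $\langle X,d\rangle$ be a uniformly paracompact metric space. Then $X$ is uniformly star superparacompact if and only if for every $\varepsilon>0$ there exists $\delta>0$ such that for every $x\in X$ there are finitely many points $x_1,\dots,x_k\in X$ with $S^\infty_d(x,\delta)\subseteq\bigcup_{i=1}^k S_d(x_i,\varepsilon)$.
   Context: Metric spaces are assumed to contain at least two points. $S_d(x,\delta)$ denotes the open ball. For $x\in X$ and $\varepsilon>0$, $S^\infty_d(x,\varepsilon)$ is the set of all $y\in X$ for which there is a finite sequence $x=x_0,x_1,\dots,x_n=y$ in $X$ with $d(x_{i-1},x_i)<\varepsilon$ for $i=1,\dots,n$. $X$ is uniformly paracompact if for each open cover $\mathcal V$ of $X$ there exist an open cover $\mathcal U$ of $X$ refining $\mathcal V$ and $\delta>0$ such that for each $x\in X$, $S_d(x,\delta)$ intersects only finitely many members of $\mathcal U$. $X$ is uniformly star superparacompact if for each open cover $\mathcal V$ of $X$ there exist $\mu>0$ and an open cover $\mathcal U$ of $X$ refining $\mathcal V$ such that for each $x\in X$, $S^\infty_d(x,\mu)$ intersects at most finitely many members of $\mathcal U$. ($\mathcal U$ refines $\mathcal V$ if each member of $\mathcal U$ is contained in some member of $\mathcal V$.) *)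

theory Defs
  imports "HOL-Analysis.Analysis"
begin

context Metric_space
begin

definition open_cover :: "'a set set \<Rightarrow> bool"
  where "open_cover \<U> \<longleftrightarrow> (\<forall>U\<in>\<U>. openin mtopology U) \<and> \<Union>\<U> = M"

definition chain_ball :: "'a \<Rightarrow> real \<Rightarrow> 'a set"
  where "chain_ball x \<epsilon> =
    {y. \<exists>(n::nat) (p :: nat \<Rightarrow> 'a).
          p 0 = x \<and> p n = y \<and> (\<forall>i\<le>n. p i \<in> M) \<and>
          (\<forall>i\<in>{1..n}. d (p (i - 1)) (p i) < \<epsilon>)}"

definition uniformly_paracompact :: bool
  where "uniformly_paracompact \<longleftrightarrow>
    (\<forall>\<V>. open_cover \<V> \<longrightarrow>
      (\<exists>\<U> \<delta>. open_cover \<U> \<and> (\<forall>U\<in>\<U>. \<exists>V\<in>\<V>. U \<subseteq> V) \<and> \<delta> > 0 \<and>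
        (\<forall>x\<in>M. finite {U\<in>\<U>. mball x \<delta> \<inter> U \<noteq> {}})))"

definition uniformly_star_superparacompact :: bool
  where "uniformly_star_superparacompact \<longleftrightarrow>
    (\<forall>\<V>. open_cover \<V> \<longrightarrow>
      (\<exists>\<mu> \<U>. \<mu> > 0 \<and> open_cover \<U> \<and> (\<forall>U\<in>\<U>. \<exists>V\<in>\<V>. U \<subseteq> V) \<and>
        (\<forall>x\<in>M. finite {U\<in>\<U>. chain_ball x \<mu> \<inter> U \<noteq> {}})))"

end

end

theory Submission
  imports Defs
begin

text \<open>
  Both implications trade "covered by finitely many balls" for "meets finitely many members of a cover".
  Assuming uniform star superparacompactness, refine the cover by all \<open>\<epsilon>\<close>-balls: if each chain ball meets only finitely
  many members of a cover by sets lying inside \<open>\<epsilon>\<close>-balls, then it is contained in the union of those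
  members, hence in finitely many \<open>\<epsilon>\<close>-balls.  Conversely, uniform paracompactness supplies a refinement
  \<open>\<U>\<close> and one \<open>\<epsilon>\<close> such that each \<open>\<epsilon>\<close>-ball meets finitely many members of \<open>\<U>\<close>; a set covered by
  finitely many \<open>\<epsilon>\<close>-balls then also meets finitely many, so if every \<open>\<delta>\<close>-chain ball is so covered,
  the same refinement \<open>\<U>\<close> works with chain balls of mesh \<open>\<delta>\<close>.
\<close>

lemma finite_meeting_if_finitely_covered:
  assumes "finite F" "A \<subseteq> (\<Union>z\<in>F. B z)" "\<And>z. z \<in> F \<Longrightarrow> finite {U\<in>\<U>. B z \<inter> U \<noteq> {}}"
  shows "finite {U\<in>\<U>. A \<inter> U \<noteq> {}}"
proof (rule finite_subset)
  show "{U\<in>\<U>. A \<inter> U \<noteq> {}} \<subseteq> (\<Union>z\<in>F. {U\<in>\<U>. B z \<inter> U \<noteq> {}})"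
    using assms(2) by blast
  show "finite (\<Union>z\<in>F. {U\<in>\<U>. B z \<inter> U \<noteq> {}})"
    using assms(1,3) by blast
qed

lemma finitely_covered_if_finite_meeting:
  assumes "A \<subseteq> \<Union>\<U>" "finite {U\<in>\<U>. A \<inter> U \<noteq> {}}" "\<And>U. U \<in> \<U> \<Longrightarrow> \<exists>z\<in>M. U \<subseteq> B z"
  shows "\<exists>F. finite F \<and> F \<subseteq> M \<and> A \<subseteq> (\<Union>z\<in>F. B z)"
proof -
  obtain c where c: "\<And>U. U \<in> \<U> \<Longrightarrow> c U \<in> M \<and> U \<subseteq> B (c U)"
    using assms(3) by metis
  let ?F = "c ` {U\<in>\<U>. A \<inter> U \<noteq> {}}"
  have "A \<subseteq> (\<Union>z\<in>?F. B z)"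
  proof
    fix y assume "y \<in> A"
    then obtain U where "U \<in> \<U>" "y \<in> U" using assms(1) by blast
    then show "y \<in> (\<Union>z\<in>?F. B z)" using \<open>y \<in> A\<close> c[of U] by blast
  qed
  moreover have "?F \<subseteq> M" using c by blast
  ultimately show ?thesis using assms(2) by (intro exI[of _ ?F]) simp
qed

context Metric_space
begin

lemma chain_ball_subset: "chain_ball x \<epsilon> \<subseteq> M"
  unfolding chain_ball_def by blast

lemma open_cover_mballs: "\<epsilon> > 0 \<Longrightarrow> open_cover ((\<lambda>z. mball z \<epsilon>) ` M)"
  unfolding open_cover_def by auto

lemma chain_balls_finitely_covered:
  assumes "uniformly_star_superparacompact" "\<epsilon> > 0"
  shows "\<exists>\<delta>>0. \<forall>x\<in>M. \<exists>F. finite F \<and> F \<subseteq> M \<and> chain_ball x \<delta> \<subseteq> (\<Union>z\<in>F. mball z \<epsilon>)"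
proof -
  obtain \<mu> \<U> where \<U>: "\<mu> > 0" "open_cover \<U>" "\<forall>U\<in>\<U>. \<exists>V\<in>(\<lambda>z. mball z \<epsilon>) ` M. U \<subseteq> V"
    "\<forall>x\<in>M. finite {U\<in>\<U>. chain_ball x \<mu> \<inter> U \<noteq> {}}"
    using assms(1)[unfolded uniformly_star_superparacompact_def, rule_format,
      OF open_cover_mballs[OF assms(2)]] by (elim exE conjE)
  have "\<exists>F. finite F \<and> F \<subseteq> M \<and> chain_ball x \<mu> \<subseteq> (\<Union>z\<in>F. mball z \<epsilon>)" if "x \<in> M" for x
  proof (rule finitely_covered_if_finite_meeting)
    show "chain_ball x \<mu> \<subseteq> \<Union>\<U>"
      using \<U>(2) chain_ball_subset unfolding open_cover_def by simp
  qed (use \<U> that in auto)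
  then show ?thesis using \<U>(1) by (intro exI[of _ \<mu>] conjI ballI)
qed

lemma uniformly_star_superparacompactI:
  assumes "uniformly_paracompact"
    and cov: "\<And>\<epsilon>. \<epsilon> > 0 \<Longrightarrow>
      \<exists>\<delta>>0. \<forall>x\<in>M. \<exists>F. finite F \<and> F \<subseteq> M \<and> chain_ball x \<delta> \<subseteq> (\<Union>z\<in>F. mball z \<epsilon>)"
  shows "uniformly_star_superparacompact"
  unfolding uniformly_star_superparacompact_def
proof (intro allI impI)
  fix \<V> assume "open_cover \<V>"
  obtain \<U> \<epsilon> where \<U>: "open_cover \<U>" "\<forall>U\<in>\<U>. \<exists>V\<in>\<V>. U \<subseteq> V" "\<epsilon> > 0"
    "\<forall>x\<in>M. finite {U\<in>\<U>. mball x \<epsilon> \<inter> U \<noteq> {}}"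
    using assms(1)[unfolded uniformly_paracompact_def, rule_format, OF \<open>open_cover \<V>\<close>] by (elim exE conjE)
  obtain \<delta> where \<delta>: "\<delta> > 0"
    "\<forall>x\<in>M. \<exists>F. finite F \<and> F \<subseteq> M \<and> chain_ball x \<delta> \<subseteq> (\<Union>z\<in>F. mball z \<epsilon>)"
    using cov[OF \<U>(3)] by (elim exE conjE)
  have "finite {U\<in>\<U>. chain_ball x \<delta> \<inter> U \<noteq> {}}" if x: "x \<in> M" for x
  proof -
    obtain F where "F \<subseteq> M" "finite F" "chain_ball x \<delta> \<subseteq> (\<Union>z\<in>F. mball z \<epsilon>)"
      using \<delta>(2)[rule_format, OF x] by (elim exE conjE)
    from this(2,3) \<U>(4)[rule_format, OF subsetD[OF this(1)]] show ?thesis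
      by (rule finite_meeting_if_finitely_covered)
  qed
  then show "\<exists>\<mu> \<U>. \<mu> > 0 \<and> open_cover \<U> \<and> (\<forall>U\<in>\<U>. \<exists>V\<in>\<V>. U \<subseteq> V) \<and>
      (\<forall>x\<in>M. finite {U\<in>\<U>. chain_ball x \<mu> \<inter> U \<noteq> {}})"
    using \<U>(1,2) \<delta>(1) by blast
qed

end

theorem mainTheorem5:
  fixes X :: "'a set" and d :: "'a \<Rightarrow> 'a \<Rightarrow> real"
  assumes "Metric_space X d"
    and "\<exists>x\<in>X. \<exists>y\<in>X. x \<noteq> y"
    and "Metric_space.uniformly_paracompact X d"
  shows "Metric_space.uniformly_star_superparacompact X d \<longleftrightarrow>
    (\<forall>\<epsilon>>0. \<exists>\<delta>>0. \<forall>x\<in>X. \<exists>F. finite F \<and> F \<subseteq> X \<and>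
       Metric_space.chain_ball X d x \<delta> \<subseteq> (\<Union>z\<in>F. Metric_space.mball X d z \<epsilon>))"
proof -
  interpret Metric_space X d by (fact assms(1))
  show ?thesis
  proof (intro iffI allI impI)
    fix \<epsilon> :: real assume "uniformly_star_superparacompact" "\<epsilon> > 0"
    then show "\<exists>\<delta>>0. \<forall>x\<in>X. \<exists>F. finite F \<and> F \<subseteq> X \<and> chain_ball x \<delta> \<subseteq> (\<Union>z\<in>F. mball z \<epsilon>)"
      by (rule chain_balls_finitely_covered)
  next
    assume "\<forall>\<epsilon>>0. \<exists>\<delta>>0. \<forall>x\<in>X. \<exists>F. finite F \<and> F \<subseteq> X \<and> chain_ball x \<delta> \<subseteq> (\<Union>z\<in>F. mball z \<epsilon>)"
    then show "uniformly_star_superparacompact"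
      by (intro uniformly_star_superparacompactI[OF assms(3)]) simp
  qed
qed

end
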